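(* Let $G$ be a locally compact, locally trivial groupoid with unit space $G^{(0)}$. Let $x\in G^{(0)}$. Assume that $\lambda$ is a fully supported positive Radon measure on the transversal $G^x$ which is $G_x^x$-invariant for the left multiplication action of $G_x^x$ on $G^x$. For $w\in G^{(0)}$ define $\lambda_G^w$ by $$\int_G g\,d\lambda_G^w=\int_{G^x} g(\eta^{-1}z)\,d\lambda(z),\qquad g\in C_c(G),$$ where $\eta\in G^x_w$ is any chosen arrow (the right-hand side does not depend on this choice). Then $\lambda_G=\{\lambda_G^w\}_{w\in G^{(0)}}$ is a Haar system on $G$.
   Context: **Groupoids.** For a groupoid $G$ with range and source maps $r,s\colon G\to G^{(0)}$ (arrows compose right to left: $\gamma\eta$ is defined iff $s(\gamma)=r(\eta)$), put $G^x=r^{-1}(x)$, $G_y=s^{-1}(y)$, $G^x_y=G^x\cap G_y$; $G_x^x$ is the isotropy group at $x$. A topological groupoid is a groupoid with a topology for which $r$, $s$, inversion and multiplication are continuous ($G^{(0)}\subseteq G$ with the subspace topology). It is called locally compact if its topology is locally compact (not assumed Hausdorff, but locally Hausdorff: every point has a compact Hausdorff neighbourhood) and its unit space $G^{(0)}$ is Hausdorff. $G$ is locally trivial if for every $x\in G^{(0)}$ the restricted source map $s|_{G^x}\colon G^x\to G^{(0)}$ is a surjective local homeomorphism; in particular every $G^x_w$ is nonempty. **Haar system.** A Haar system on $G$ is a family $\{\alpha^u\}_{u\in G^{(0)}}$ of positive Radon measures on $G$ such that: $\alpha^u$ has support $G^u$; for every $f\in C_c(G)$ the function $u\mapsto\int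 f\,d\alpha^u$ is in $C_c(G^{(0)})$; and for all $\gamma\in G$, $f\in C_c(G)$, $\int_{G^{s(\gamma)}} f(\gamma\eta)\,d\alpha^{s(\gamma)}(\eta)=\int_{G^{r(\gamma)}} f(\eta)\,d\alpha^{r(\gamma)}(\eta)$. *)

theory Defs
  imports "HOL-Analysis.Analysis"
begin

section \<open>Topological groupoids\<close>

text \<open>
  The arrows of a groupoid are all elements of the type; \<open>gmul G\<close> is a total function whose
  values at non-composable pairs are unspecified and never used.
\<close>

record 'g groupoid_ops =
  rng :: "'g \<Rightarrow> 'g"
  src :: "'g \<Rightarrow> 'g"
  gmul :: "'g \<Rightarrow> 'g \<Rightarrow> 'g"
  ginv :: "'g \<Rightarrow> 'g"

definition units :: "'g groupoid_ops \<Rightarrow> 'g set" where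
  "units G = range (rng G)"

definition rfib :: "'g groupoid_ops \<Rightarrow> 'g \<Rightarrow> 'g set" where
  "rfib G x = {\<gamma>. rng G \<gamma> = x}"

definition sfib :: "'g groupoid_ops \<Rightarrow> 'g \<Rightarrow> 'g set" where
  "sfib G y = {\<gamma>. src G \<gamma> = y}"

definition rsfib :: "'g groupoid_ops \<Rightarrow> 'g \<Rightarrow> 'g \<Rightarrow> 'g set" where
  "rsfib G x y = rfib G x \<inter> sfib G y"

definition composable :: "'g groupoid_ops \<Rightarrow> ('g \<times> 'g) set" where
  "composable G = {(\<gamma>, \<eta>). src G \<gamma> = rng G \<eta>}"

locale groupoid =
  fixes G :: "'g groupoid_ops"
  assumes rng_rng: "rng G (rng G \<gamma>) = rng G \<gamma>"
    and src_rng: "src G (rng G \<gamma>) = rng G \<gamma>"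
    and rng_src: "rng G (src G \<gamma>) = src G \<gamma>"
    and src_src: "src G (src G \<gamma>) = src G \<gamma>"
    and rng_gmul: "src G \<gamma> = rng G \<eta> \<Longrightarrow> rng G (gmul G \<gamma> \<eta>) = rng G \<gamma>"
    and src_gmul: "src G \<gamma> = rng G \<eta> \<Longrightarrow> src G (gmul G \<gamma> \<eta>) = src G \<eta>"
    and gmul_assoc: "src G \<gamma> = rng G \<eta> \<Longrightarrow> src G \<eta> = rng G \<zeta> \<Longrightarrow>
          gmul G (gmul G \<gamma> \<eta>) \<zeta> = gmul G \<gamma> (gmul G \<eta> \<zeta>)"
    and gmul_rng: "gmul G (rng G \<gamma>) \<gamma> = \<gamma>"
    and gmul_src: "gmul G \<gamma> (src G \<gamma>) = \<gamma>"
    and rng_ginv: "rng G (ginv G \<gamma>) = src G \<gamma>"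
    and src_ginv: "src G (ginv G \<gamma>) = rng G \<gamma>"
    and gmul_ginv: "gmul G \<gamma> (ginv G \<gamma>) = rng G \<gamma>"
    and ginv_gmul: "gmul G (ginv G \<gamma>) \<gamma> = src G \<gamma>"

locale topological_groupoid = groupoid G
  for G :: "'g::topological_space groupoid_ops" +
  assumes continuous_rng: "continuous_on UNIV (rng G)"
    and continuous_src: "continuous_on UNIV (src G)"
    and continuous_ginv: "continuous_on UNIV (ginv G)"
    and continuous_gmul: "continuous_on (composable G) (\<lambda>(\<gamma>, \<eta>). gmul G \<gamma> \<eta>)"

text \<open>Only the unit space is required to be Hausdorff; the arrow space is locally Hausdorff.\<close>

locale locally_compact_groupoid = topological_groupoid G
  for G :: "'g::topological_space groupoid_ops" +
  assumes compact_Hausdorff_nhd: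
      "\<exists>U K. open U \<and> (\<gamma> :: 'g) \<in> U \<and> U \<subseteq> K \<and> compact K \<and> Hausdorff_space (top_of_set K)"
    and Hausdorff_units: "Hausdorff_space (top_of_set (units G))"

definition local_homeomorphism_on ::
  "'a::topological_space set \<Rightarrow> 'b::topological_space set \<Rightarrow> ('a \<Rightarrow> 'b) \<Rightarrow> bool" where
  "local_homeomorphism_on S T f \<longleftrightarrow>
     (\<forall>p\<in>S. \<exists>U V g. p \<in> U \<and> openin (top_of_set S) U \<and> openin (top_of_set T) V \<and>
        homeomorphism U V f g)"

definition locally_trivial :: "'g::topological_space groupoid_ops \<Rightarrow> bool" where
  "locally_trivial G \<longleftrightarrow>
     (\<forall>x\<in>units G. local_homeomorphism_on (rfib G x) (units G) (src G) \<and>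
        src G ` rfib G x = units G)"


section \<open>Compactly supported functions and Radon measures\<close>

text \<open>
  Only the restriction of \<open>f\<close> to \<open>S\<close> matters; \<open>S \<inter> closure A\<close> is the closure of \<open>A\<close> relative to \<open>S\<close>.
  For a non-Hausdorff groupoid one would replace this by the linear span of the spaces
  \<open>C\<^sub>c(U)\<close> with \<open>U\<close> open and Hausdorff. A locally trivial locally compact groupoid is
  automatically Hausdorff, so there the two coincide: arrows with different range or source are
  separated by \<open>rng\<close> or \<open>src\<close>, and local sections of \<open>src\<close> on \<open>rfib G x\<close> identify \<open>G\<close> locally
  with \<open>V \<times> rsfib G x x \<times> U\<close> for \<open>U\<close>, \<open>V\<close> open in the unit space, with discrete isotropy.
\<close>

definition Cc :: "'a::topological_space set \<Rightarrow> ('a \<Rightarrow> complex) set" where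
  "Cc S = {f. continuous_on S f \<and> compact (S \<inter> closure {z\<in>S. f z \<noteq> 0})}"

text \<open>
  A Radon measure on the subspace \<open>S\<close> is a Borel measure on \<open>S\<close> that is finite on compact sets,
  outer regular on Borel sets and inner regular on open sets. On a locally compact Hausdorff space
  these are the measures that correspond to the positive linear functionals on \<open>C\<^sub>c(S)\<close>; no
  countability of the topology is assumed.
\<close>

definition radon_measure_on :: "'a::topological_space set \<Rightarrow> 'a measure \<Rightarrow> bool" where
  "radon_measure_on S M \<longleftrightarrow>
     sets M = sets (restrict_space borel S) \<and>
     (\<forall>K. compact K \<and> K \<subseteq> S \<longrightarrow> emeasure M K < \<infinity>) \<and>
     (\<forall>A\<in>sets M. emeasure M A =
        (INF U\<in>{U. openin (top_of_set S) U \<and> A \<subseteq> U}. emeasure M U)) \<and>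
     (\<forall>U. openin (top_of_set S) U \<longrightarrow>
        emeasure M U = (SUP K\<in>{K. compact K \<and> K \<subseteq> U}. emeasure M K))"

definition measure_support :: "'a::topological_space measure \<Rightarrow> 'a set" where
  "measure_support M =
     {p\<in>space M. \<forall>U. open U \<and> p \<in> U \<longrightarrow> emeasure M (U \<inter> space M) > 0}"


section \<open>Haar systems\<close>

definition haar_system ::
  "'g::topological_space groupoid_ops \<Rightarrow> ('g \<Rightarrow> 'g measure) \<Rightarrow> bool" where
  "haar_system G \<alpha> \<longleftrightarrow>
     (\<forall>u\<in>units G. radon_measure_on UNIV (\<alpha> u) \<and> measure_support (\<alpha> u) = rfib G u) \<and>
     (\<forall>f\<in>Cc UNIV. (\<lambda>u. integral\<^sup>L (\<alpha> u) f) \<in> Cc (units G)) \<and>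
     (\<forall>\<gamma>. \<forall>f\<in>Cc UNIV.
        (LINT \<eta>:rfib G (src G \<gamma>)|\<alpha> (src G \<gamma>). f (gmul G \<gamma> \<eta>)) =
        (LINT \<eta>:rfib G (rng G \<gamma>)|\<alpha> (rng G \<gamma>). f \<eta>))"

definition isotropy_invariant ::
  "'g groupoid_ops \<Rightarrow> 'g \<Rightarrow> 'g measure \<Rightarrow> bool" where
  "isotropy_invariant G x L \<longleftrightarrow>
     (\<forall>\<gamma>\<in>rsfib G x x. \<forall>A\<in>sets L. emeasure L (gmul G \<gamma> ` A) = emeasure L A)"

text \<open>
  \<open>M\<close> is the Radon measure on \<open>G\<close> given by \<open>g \<mapsto> \<integral> g (\<eta>\<inverse> z) dL(z)\<close>, where \<open>L\<close> is a measure
  on \<open>rfib G x\<close>.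
\<close>

definition is_translate ::
  "'g::topological_space groupoid_ops \<Rightarrow> 'g \<Rightarrow> 'g measure \<Rightarrow> 'g \<Rightarrow> 'g measure \<Rightarrow> bool" where
  "is_translate G x L w M \<longleftrightarrow> radon_measure_on UNIV M \<and>
     (\<forall>\<eta>\<in>rsfib G x w. \<forall>g\<in>Cc UNIV.
        integral\<^sup>L M g = (LINT z|L. g (gmul G (ginv G \<eta>) z)))"

definition induced_system ::
  "'g::topological_space groupoid_ops \<Rightarrow> 'g \<Rightarrow> 'g measure \<Rightarrow> 'g \<Rightarrow> 'g measure" where
  "induced_system G x L w = (THE M. is_translate G x L w M)"

end

theory Submission
  imports Defs
begin

text \<open>
  The measure \<open>\<lambda>\<^sub>G\<^sup>w\<close> is the image of \<open>L\<close> under the homeomorphism \<open>z \<mapsto> \<eta>\<inverse> z\<close> from \<open>rfib G x\<close> onto the closed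
  set \<open>rfib G w\<close>; hence it is Radon with support \<open>rfib G w\<close>. Two choices of \<open>\<eta>\<close> differ by an element of
  the isotropy group at \<open>x\<close>, and replacing \<open>\<eta>\<close> by \<open>\<eta> \<gamma>\<inverse>\<close> gives left invariance. Local triviality makes \<open>G\<close>
  Hausdorff, so that Urysohn functions determine a Radon measure, and it lets \<open>\<eta>\<close> vary continuously
  with \<open>w\<close>, which gives the continuity of \<open>w \<mapsto> \<integral> f d\<lambda>\<^sub>G\<^sup>w\<close>.
\<close>

section \<open>Radon measures\<close>

lemma radon_measure_on_sets: "radon_measure_on S M \<Longrightarrow> sets M = sets (restrict_space borel S)"
  by (simp add: radon_measure_on_def)

lemma radon_measure_on_space: "radon_measure_on S M \<Longrightarrow> space M = S"
  using sets_eq_imp_space_eq[of M "restrict_space borel S"]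
  by (simp add: radon_measure_on_def space_restrict_space)

lemma radon_measure_on_UNIV_sets: "radon_measure_on UNIV M \<Longrightarrow> sets M = sets borel"
  by (auto simp: radon_measure_on_def sets_restrict_space)

lemma radon_measure_on_finite:
  "radon_measure_on S M \<Longrightarrow> compact K \<Longrightarrow> K \<subseteq> S \<Longrightarrow> emeasure M K < \<infinity>"
  unfolding radon_measure_on_def by blast

lemma radon_measure_on_outer_regular:
  "radon_measure_on S M \<Longrightarrow> A \<in> sets M \<Longrightarrow>
    emeasure M A = (INF U\<in>{U. openin (top_of_set S) U \<and> A \<subseteq> U}. emeasure M U)"
  unfolding radon_measure_on_def by blast

lemma radon_measure_on_inner_regular:
  "radon_measure_on S M \<Longrightarrow> openin (top_of_set S) U \<Longrightarrow>
    emeasure M U = (SUP K\<in>{K. compact K \<and> K \<subseteq> U}. emeasure M K)"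
  unfolding radon_measure_on_def by blast

section \<open>Compactly supported functions and the Radon measures they determine\<close>

lemma Cc_borel_measurable:
  "f \<in> Cc UNIV \<Longrightarrow> f \<in> borel_measurable borel"
  by (simp add: Cc_def borel_measurable_continuous_onI)

lemma Cc_UNIV_bounded:
  fixes f :: "'a::topological_space \<Rightarrow> complex"
  assumes "f \<in> Cc UNIV"
  obtains B where "\<And>z. norm (f z) \<le> B"
proof -
  let ?K = "closure {z. f z \<noteq> 0}"
  have "compact (f ` ?K)"
    using assms by (intro compact_continuous_image) (auto simp: Cc_def intro: continuous_on_subset)
  then obtain B where B: "\<And>z. z \<in> ?K \<Longrightarrow> norm (f z) \<le> B"
    by (meson bounded_iff compact_imp_bounded imageI)
  \<comment> \<open>If the closure is empty, \<open>B\<close> may be negative; the maximum with 0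
    covers the points where \<open>f\<close> vanishes.\<close>
  have "norm (f z) \<le> max B 0" for z
    using B[of z] closure_subset[of "{z. f z \<noteq> 0}"] by (cases "f z = 0") (auto simp: le_max_iff_disj)
  then show thesis
    by (rule that)
qed

lemma radon_measure_on_UNIV_integrable_Cc:
  assumes M: "radon_measure_on UNIV M" and f: "f \<in> Cc UNIV"
  shows "integrable M f"
proof -
  obtain B where B: "\<And>z. norm (f z) \<le> B"
    using Cc_UNIV_bounded[OF f] by blast
  let ?K = "closure {z. f z \<noteq> 0}"
  have "?K \<in> sets M"
    by (simp add: radon_measure_on_UNIV_sets[OF M])
  moreover have "emeasure M ?K < \<infinity>"
    using f by (intro radon_measure_on_finite[OF M]) (simp_all add: Cc_def)
  moreover have "f \<in> borel_measurable M"
    using Cc_borel_measurable[OF f] radon_measure_on_UNIV_sets[OF M] measurable_cong_sets by blast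
  moreover have "AE z in M. z \<notin> ?K \<longrightarrow> f z = 0"
    using closure_subset[of "{z. f z \<noteq> 0}"] by auto
  ultimately show ?thesis
    using B by (intro integrableI_bounded_set[where A = ?K and B = B]) auto
qed

text \<open>Locally compact Hausdorff spaces are completely regular, so a Urysohn function exists.
  It is made to vanish off \<open>U \<inter> V\<close>, not merely off \<open>U\<close>, where
  \<open>V\<close> is an open neighbourhood of \<open>K\<close> inside a compact closed set
  \<open>L\<close>; this forces its support into \<open>L\<close>.\<close>

lemma Cc_Urysohn:
  fixes K U :: "'a::topological_space set"
  assumes H: "Hausdorff_space (euclidean :: 'a topology)"
    and LC: "locally_compact_space (euclidean :: 'a topology)"
    and "compact K" "open U" "K \<subseteq> U"
  obtains h :: "'a \<Rightarrow> real" where "\<And>z. 0 \<le> h z" "\<And>z. h z \<le> 1" "\<And>z. z \<in> K \<Longrightarrow> h z = 1"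
    "\<And>z. z \<notin> U \<Longrightarrow> h z = 0" "(\<lambda>z. complex_of_real (h z)) \<in> Cc UNIV"
proof -
  obtain V L where V: "open V" "compact L" "closed L" "K \<subseteq> V" "V \<subseteq> L"
    using locally_compact_space_compact_closed_compact[of "euclidean :: 'a topology"] H LC \<open>compact K\<close>
    by auto
  have "completely_regular_space (euclidean :: 'a topology)"
    using H LC locally_compact_regular_imp_completely_regular_space by blast
  moreover have "closedin euclidean (- (U \<inter> V))"
    using V \<open>open U\<close> by (metis closed_Compl closed_closedin open_Int)
  moreover have "disjnt K (- (U \<inter> V))"
    using V \<open>K \<subseteq> U\<close> by (auto simp: disjnt_iff)
  ultimately obtain f where f: "continuous_map euclidean (top_of_set {0..1::real}) f"
      "f ` (- (U \<inter> V)) \<subseteq> {0}" "f ` K \<subseteq> {1}"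
    using Urysohn_completely_regular_closed_compact[of 0 1 euclidean "- (U \<inter> V)" K]
      Urysohn_completely_regular_compact_closed[of 0 1 euclidean K "- (U \<inter> V)"] \<open>compact K\<close>
    by (metis compactin_euclidean_iff zero_le_one)
  have cont: "continuous_on UNIV f" and f01: "\<And>z. 0 \<le> f z \<and> f z \<le> 1"
    using f(1) by (auto simp: continuous_map_in_subtopology Pi_iff)
  have "closure {z. complex_of_real (f z) \<noteq> 0} \<subseteq> L"
    using f(2) V by (intro closure_minimal) auto
  then have "compact (closure {z. complex_of_real (f z) \<noteq> 0})"
    using \<open>compact L\<close> by (metis closed_closure compact_Int_closed inf.absorb_iff2)
  then have "(\<lambda>z. complex_of_real (f z)) \<in> Cc UNIV"
    using cont by (auto simp: Cc_def intro!: continuous_intros)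
  then show thesis
    using f01 f(2,3) by (intro that[of f]) auto
qed

text \<open>The uniqueness half of the Riesz representation theorem. A Urysohn function between the
  indicators of a compact \<open>K\<close> and an open \<open>U\<close> compares the measure of
  \<open>K\<close> with that of \<open>U\<close>; inner regularity passes to open sets and outer
  regularity to all Borel sets.\<close>

lemma radon_measure_on_eqI:
  fixes M N :: "'a::topological_space measure"
  assumes H: "Hausdorff_space (euclidean :: 'a topology)"
    and LC: "locally_compact_space (euclidean :: 'a topology)"
    and M: "radon_measure_on UNIV M" and N: "radon_measure_on UNIV N"
    and eq: "\<And>f. f \<in> Cc UNIV \<Longrightarrow> integral\<^sup>L M f = integral\<^sup>L N f"
  shows "M = N"
proof -
  \<comment> \<open>The measures are quantified afresh so that the inequality can be applied with
    their roles exchanged.\<close>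
  have le: "emeasure M U \<le> emeasure N U"
    if M: "radon_measure_on UNIV M" and N: "radon_measure_on UNIV N"
      and eq: "\<And>f. f \<in> Cc UNIV \<Longrightarrow> integral\<^sup>L M f = integral\<^sup>L N f" and U: "open U"
    for M N :: "'a measure" and U
  proof -
    have "emeasure M K \<le> emeasure N U" if K: "compact K" "K \<subseteq> U" for K
    proof -
      have sets: "sets M = sets borel" "sets N = sets borel"
        using M N by (simp_all add: radon_measure_on_UNIV_sets)
      have KU: "K \<in> sets M" "U \<in> sets N"
        using compactin_imp_closedin[OF H, of K] K U sets by auto
      obtain h :: "'a \<Rightarrow> real" where h: "\<And>z. 0 \<le> h z" "\<And>z. h z \<le> 1" "\<And>z. z \<in> K \<Longrightarrow> h z = 1"
          "\<And>z. z \<notin> U \<Longrightarrow> h z = 0" "(\<lambda>z. complex_of_real (h z)) \<in> Cc UNIV"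
        using Cc_Urysohn[OF H LC K(1) U K(2)] by blast
      have int: "integrable M h" "integrable N h"
        using radon_measure_on_UNIV_integrable_Cc[OF M h(5)]
          radon_measure_on_UNIV_integrable_Cc[OF N h(5)]
        by (simp_all add: complex_of_real_integrable_eq)
      have "emeasure M K = (\<integral>\<^sup>+z. indicator K z \<partial>M)"
        using KU by simp
      also have "\<dots> \<le> (\<integral>\<^sup>+z. h z \<partial>M)"
        using h(3) by (intro nn_integral_mono) (auto simp: indicator_def)
      also have "\<dots> = ennreal (integral\<^sup>L M h)"
        using h(1) int by (intro nn_integral_eq_integral) auto
      also have "integral\<^sup>L M h = integral\<^sup>L N h"
        using eq[OF h(5)] by simp
      also have "ennreal \<dots> = (\<integral>\<^sup>+z. h z \<partial>N)"
        using h(1) int by (intro nn_integral_eq_integral[symmetric]) auto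
      also have "\<dots> \<le> (\<integral>\<^sup>+z. indicator U z \<partial>N)"
        using h(2,4) by (intro nn_integral_mono) (auto simp: indicator_def)
      also have "\<dots> = emeasure N U"
        using KU by simp
      finally show ?thesis .
    qed
    moreover have "emeasure M U = (SUP K\<in>{K. compact K \<and> K \<subseteq> U}. emeasure M K)"
      using radon_measure_on_inner_regular[OF M, of U] U by simp
    ultimately show ?thesis
      by (auto intro!: SUP_least)
  qed
  have open_eq: "emeasure M U = emeasure N U" if "open U" for U
    using le[OF M N eq that] le[OF N M eq[symmetric] that] by (rule antisym)
  have sets: "sets M = sets borel" "sets N = sets borel"
    using M N by (simp_all add: radon_measure_on_UNIV_sets)
  show ?thesis
  proof (rule measure_eqI)
    show "sets M = sets N"
      using sets by simp
    fix A assume "A \<in> sets M"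
    then have A: "A \<in> sets M" "A \<in> sets N"
      using sets by simp_all
    have "emeasure M A = (INF U\<in>{U. open U \<and> A \<subseteq> U}. emeasure M U)"
      "emeasure N A = (INF U\<in>{U. open U \<and> A \<subseteq> U}. emeasure N U)"
      using radon_measure_on_outer_regular[OF M A(1)] radon_measure_on_outer_regular[OF N A(2)] by simp_all
    then show "emeasure M A = emeasure N A"
      using open_eq by (simp cong: INF_cong_simp)
  qed
qed

section \<open>Images of Radon measures under homeomorphisms onto closed sets\<close>

context
  fixes S T :: "'a::topological_space set" and f g and L :: "'a measure"
  assumes L: "radon_measure_on S L" and T: "closed T" and fg: "homeomorphism S T f g"
begin

lemma measurable_homeomorphism: "f \<in> measurable L borel"
proof -
  have "f \<in> borel_measurable (restrict_space borel S)"
    using fg by (intro borel_measurable_continuous_on_restrict) (simp add: homeomorphism_def)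
  then show ?thesis
    using measurable_cong_sets[OF radon_measure_on_sets[OF L] refl] by blast
qed

lemma emeasure_distr_homeomorphism:
  assumes "A \<in> sets borel"
  shows "emeasure (distr L borel f) A = emeasure L (S \<inter> f -` A)"
  using emeasure_distr[OF measurable_homeomorphism assms] radon_measure_on_space[OF L]
  by (simp add: Int_commute)

text \<open>The homeomorphism matches compact and relatively open subsets of \<open>S\<close> with
  those of \<open>T\<close>, so each regularity property is carried over. Closedness of
  \<open>T\<close> makes \<open>K \<inter> T\<close> compact and \<open>- T\<close> open; the
  Hausdorff property makes compact sets Borel.\<close>

lemma radon_measure_on_distr:
  assumes H: "Hausdorff_space (euclidean :: 'a topology)"
  shows "radon_measure_on UNIV (distr L borel f)"
  unfolding radon_measure_on_def
proof (intro conjI allI impI ballI)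
  let ?M = "distr L borel f"
  have contf: "continuous_on S f" and contg: "continuous_on T g" and fS: "f ` S = T" and gT: "g ` T = S"
    and gf: "\<And>z. z \<in> S \<Longrightarrow> g (f z) = z" and fg': "\<And>z. z \<in> T \<Longrightarrow> f (g z) = z"
    using fg by (auto simp: homeomorphism_def)
  have fT: "\<And>z. z \<in> S \<Longrightarrow> f z \<in> T" and gS: "\<And>z. z \<in> T \<Longrightarrow> g z \<in> S"
    using fS gT by blast+
  \<comment> \<open>Written as an image under \<open>g\<close>, the preimage of a compact set is
    seen to be compact.\<close>
  have preimage: "S \<inter> f -` K = g ` (K \<inter> T)" for K
  proof
    show "S \<inter> f -` K \<subseteq> g ` (K \<inter> T)"
    proof
      fix z assume "z \<in> S \<inter> f -` K"
      then show "z \<in> g ` (K \<inter> T)"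
        using gf[of z] fT[of z] by (intro image_eqI[of z g "f z"]) auto
    qed
    show "g ` (K \<inter> T) \<subseteq> S \<inter> f -` K"
      using fg' gS by auto
  qed
  have borel: "A \<in> sets borel" if "compact A" for A :: "'a set"
    using compactin_imp_closedin[OF H, of A] that by auto
  show "sets ?M = sets (restrict_space borel UNIV)"
    by (simp add: sets_restrict_space)
  show "emeasure ?M K < \<infinity>" if "compact K \<and> K \<subseteq> UNIV" for K
  proof -
    have "compact (g ` (K \<inter> T))"
      using that T contg by (intro compact_continuous_image) (auto intro: continuous_on_subset)
    then show ?thesis
      using preimage[of K] radon_measure_on_finite[OF L, of "S \<inter> f -` K"] that borel
      by (auto simp: emeasure_distr_homeomorphism gS image_subset_iff)
  qed
  show "emeasure ?M A = (INF U\<in>{U. openin (top_of_set UNIV) U \<and> A \<subseteq> U}. emeasure ?M U)"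
    if "A \<in> sets ?M" for A
  proof -
    have A: "A \<in> sets borel"
      using that by simp
    have "S \<inter> f -` A \<in> sets L"
      using measurable_sets[OF measurable_homeomorphism A] radon_measure_on_space[OF L]
      by (simp add: Int_commute)
    then have "emeasure ?M A =
        (INF V\<in>{V. openin (top_of_set S) V \<and> S \<inter> f -` A \<subseteq> V}. emeasure L V)"
      using A by (simp add: emeasure_distr_homeomorphism radon_measure_on_outer_regular[OF L])
    also have "\<dots> = (INF U\<in>{U. open U \<and> A \<subseteq> U}. emeasure ?M U)"
    proof (rule INF_eq)
      fix V assume "V \<in> {V. openin (top_of_set S) V \<and> S \<inter> f -` A \<subseteq> V}"
      then have V: "openin (top_of_set S) V" "S \<inter> f -` A \<subseteq> V"
        by auto
      then have "openin (top_of_set T) (T \<inter> g -` V)"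
        using contg gT by (intro continuous_openin_preimage) auto
      then obtain W where W: "open W" "T \<inter> g -` V = T \<inter> W"
        by (auto simp: openin_open)
      \<comment> \<open>Adding \<open>- T\<close> covers the points of \<open>A\<close> outside the
        image of \<open>f\<close> and leaves the preimage under \<open>f\<close> unchanged.\<close>
      let ?U = "W \<union> - T"
      have U: "open ?U"
        using W T by auto
      have AU: "A \<subseteq> ?U"
      proof
        fix a assume "a \<in> A"
        then have "a \<in> T \<Longrightarrow> g a \<in> V"
          using V(2) gS[of a] fg'[of a] by auto
        then show "a \<in> ?U"
          using W by blast
      qed
      have "S \<inter> f -` ?U = V"
      proof -
        have "f z \<in> W \<longleftrightarrow> z \<in> V" if "z \<in> S" for z
          using W(2) fT[OF that] gf[OF that] by (metis Int_iff vimage_eq)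
        then show ?thesis
          using openin_imp_subset[OF V(1)] fT by auto
      qed
      then have "emeasure ?M ?U \<le> emeasure L V"
        using U by (simp add: emeasure_distr_homeomorphism)
      then show "\<exists>U\<in>{U. open U \<and> A \<subseteq> U}. emeasure ?M U \<le> emeasure L V"
        using U AU by blast
    next
      fix U assume "U \<in> {U. open U \<and> A \<subseteq> U}"
      then have U: "open U" "A \<subseteq> U"
        by auto
      then have "openin (top_of_set S) (S \<inter> f -` U)"
        using contf continuous_openin_preimage_gen by blast
      then show "\<exists>V\<in>{V. openin (top_of_set S) V \<and> S \<inter> f -` A \<subseteq> V}. emeasure L V \<le> emeasure ?M U"
        using U by (intro bexI[of _ "S \<inter> f -` U"]) (auto simp: emeasure_distr_homeomorphism)
    qed
    finally show ?thesis
      by simp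
  qed
  show "emeasure ?M U = (SUP K\<in>{K. compact K \<and> K \<subseteq> U}. emeasure ?M K)"
    if "openin (top_of_set UNIV) U" for U
  proof -
    have U: "open U"
      using that by simp
    have "openin (top_of_set S) (S \<inter> f -` U)"
      using contf U continuous_openin_preimage_gen by blast
    then have "emeasure ?M U = (SUP K\<in>{K. compact K \<and> K \<subseteq> S \<inter> f -` U}. emeasure L K)"
      using U by (simp add: emeasure_distr_homeomorphism radon_measure_on_inner_regular[OF L])
    also have "\<dots> = (SUP K\<in>{K. compact K \<and> K \<subseteq> U}. emeasure ?M K)"
    \<comment> \<open>Compact sets are matched in one direction by their image under
      \<open>f\<close>, which is injective on \<open>S\<close>, and in the other by their
      preimage.\<close>
    proof (rule SUP_eq)
      fix K assume "K \<in> {K. compact K \<and> K \<subseteq> S \<inter> f -` U}"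
      then have K: "compact K" "K \<subseteq> S" "f ` K \<subseteq> U"
        by auto
      have "compact (f ` K)"
        using K contf by (intro compact_continuous_image) (auto intro: continuous_on_subset)
      moreover have "S \<inter> f -` f ` K = K"
      proof
        show "S \<inter> f -` f ` K \<subseteq> K"
        proof
          fix z assume "z \<in> S \<inter> f -` f ` K"
          then obtain y where "y \<in> K" "f z = f y" "z \<in> S"
            by auto
          then have "z = y"
            using gf[of z] gf[of y] K(2) by auto
          with \<open>y \<in> K\<close> show "z \<in> K"
            by simp
        qed
      qed (use K in auto)
      ultimately have "emeasure L K \<le> emeasure ?M (f ` K)"
        using borel by (simp add: emeasure_distr_homeomorphism)
      then show "\<exists>K'\<in>{K. compact K \<and> K \<subseteq> U}. emeasure L K \<le> emeasure ?M K'"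
        using K \<open>compact (f ` K)\<close> by blast
    next
      fix K assume "K \<in> {K. compact K \<and> K \<subseteq> U}"
      then have K: "compact K" "K \<subseteq> U"
        by auto
      have "compact (g ` (K \<inter> T))"
        using K T contg by (intro compact_continuous_image) (auto intro: continuous_on_subset)
      then show "\<exists>K'\<in>{K. compact K \<and> K \<subseteq> S \<inter> f -` U}. emeasure ?M K \<le> emeasure L K'"
        using preimage[of K] K borel by (intro bexI[of _ "S \<inter> f -` K"]) (auto simp: emeasure_distr_homeomorphism)
    qed
    finally show ?thesis .
  qed
qed

end

section \<open>Groupoids\<close>

context groupoid
begin

lemma rng_in_units [simp]: "rng G \<gamma> \<in> units G"
  by (simp add: units_def)

lemma src_in_units [simp]: "src G \<gamma> \<in> units G"
  by (metis rng_in_units rng_src)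

lemma unit_rng: "u \<in> units G \<Longrightarrow> rng G u = u"
  and unit_src: "u \<in> units G \<Longrightarrow> src G u = u"
  by (auto simp: units_def rng_rng src_rng)

lemma unit_ginv: "u \<in> units G \<Longrightarrow> ginv G u = u"
  by (metis ginv_gmul gmul_src src_ginv unit_rng unit_src)

lemma gmul_unit_left: "u \<in> units G \<Longrightarrow> rng G \<gamma> = u \<Longrightarrow> gmul G u \<gamma> = \<gamma>"
  using gmul_rng by blast

lemma gmul_unit_right: "u \<in> units G \<Longrightarrow> src G \<gamma> = u \<Longrightarrow> gmul G \<gamma> u = \<gamma>"
  using gmul_src by blast

lemma gmul_ginv_cancel_left: "rng G z = rng G \<eta> \<Longrightarrow> gmul G \<eta> (gmul G (ginv G \<eta>) z) = z"
  by (metis gmul_assoc gmul_ginv gmul_rng rng_ginv src_ginv)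

lemma ginv_gmul_cancel_left: "rng G z = src G \<eta> \<Longrightarrow> gmul G (ginv G \<eta>) (gmul G \<eta> z) = z"
  by (metis gmul_assoc ginv_gmul gmul_rng src_ginv)

lemma rng_gmul_ginv: "rng G z = rng G \<eta> \<Longrightarrow> rng G (gmul G (ginv G \<eta>) z) = src G \<eta>"
  by (simp add: rng_ginv rng_gmul src_ginv)

lemma gmul_gmul_ginv:
  assumes "src G \<zeta> = src G \<gamma>" "rng G z = rng G \<gamma>"
  shows "gmul G (gmul G \<zeta> (ginv G \<gamma>)) z = gmul G \<zeta> (gmul G (ginv G \<gamma>) z)"
  using assms by (simp add: gmul_assoc rng_ginv src_ginv)

text \<open>For \<open>y = x\<close> the product is the isotropy element by which two choices of
  arrow differ; for general \<open>y\<close> it moves a chosen arrow from one source to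
  another.\<close>

lemma gmul_ginv_in_rsfib:
  assumes "\<eta> \<in> rsfib G x w" "\<eta>' \<in> rsfib G y w"
  shows "gmul G \<eta> (ginv G \<eta>') \<in> rsfib G x y"
  using assms by (auto simp: rsfib_def rfib_def sfib_def rng_gmul src_gmul rng_ginv src_ginv)

end

section \<open>Continuous operations and local sections of the source map\<close>

context topological_groupoid
begin

lemma continuous_on_gmul:
  assumes "continuous_on S a" "continuous_on S b" "\<And>z. z \<in> S \<Longrightarrow> src G (a z) = rng G (b z)"
  shows "continuous_on S (\<lambda>z. gmul G (a z) (b z))"
proof -
  have "continuous_on S (\<lambda>z. (\<lambda>(\<gamma>, \<eta>). gmul G \<gamma> \<eta>) (a z, b z))"
    by (rule continuous_on_compose2[OF continuous_gmul])
      (use assms in \<open>auto simp: composable_def intro: continuous_on_Pair\<close>)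
  then show ?thesis
    by simp
qed

lemma continuous_on_ginv:
  "continuous_on S a \<Longrightarrow> continuous_on S (\<lambda>z. ginv G (a z))"
  using continuous_on_compose2[OF continuous_ginv] by blast

lemma open_rng_vimage: "open U \<Longrightarrow> open (rng G -` U)"
  and open_src_vimage: "open U \<Longrightarrow> open (src G -` U)"
  using continuous_rng continuous_src by (simp_all add: continuous_on_open_vimage)

text \<open>The two cancellation laws make left multiplications by \<open>\<eta>\<close> and by its
  inverse mutually inverse, and each is continuous because its arguments stay composable.\<close>

lemma homeomorphism_gmul_ginv:
  "homeomorphism (rfib G (rng G \<eta>)) (rfib G (src G \<eta>)) (gmul G (ginv G \<eta>)) (gmul G \<eta>)"
proof (rule homeomorphismI)
  show "continuous_on (rfib G (rng G \<eta>)) (gmul G (ginv G \<eta>))"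
    by (rule continuous_on_gmul) (auto simp: rfib_def src_ginv)
  show "continuous_on (rfib G (src G \<eta>)) (gmul G \<eta>)"
    by (rule continuous_on_gmul) (auto simp: rfib_def)
qed (auto simp: rfib_def rng_gmul_ginv rng_gmul gmul_ginv_cancel_left ginv_gmul_cancel_left)

lemma locally_trivial_chart:
  assumes "locally_trivial G"
  obtains U W \<sigma> where "p \<in> U" "openin (top_of_set (rfib G (rng G p))) U"
    "openin (top_of_set (units G)) W" "homeomorphism U W (src G) \<sigma>"
proof -
  have "local_homeomorphism_on (rfib G (rng G p)) (units G) (src G)"
    using assms by (simp add: locally_trivial_def)
  moreover have "p \<in> rfib G (rng G p)"
    by (simp add: rfib_def)
  ultimately show thesis
    using that unfolding local_homeomorphism_on_def by blast
qed

text \<open>The inverse of a chart of the source map at \<open>p\<close> is a section through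
  \<open>p\<close>. Its domain is given as the trace of a set \<open>V\<close> open among all
  arrows, so that preimages of \<open>V\<close> under \<open>rng G\<close> and \<open>src G\<close>
  are open.\<close>

lemma locally_trivial_section:
  assumes "locally_trivial G"
  obtains V \<sigma> where "open V" "src G p \<in> V" "continuous_on (units G \<inter> V) \<sigma>" "\<sigma> (src G p) = p"
    "\<And>v. v \<in> units G \<inter> V \<Longrightarrow> rng G (\<sigma> v) = rng G p \<and> src G (\<sigma> v) = v"
proof -
  obtain U W \<sigma> where U: "p \<in> U" "openin (top_of_set (rfib G (rng G p))) U"
      and W: "openin (top_of_set (units G)) W" and hom: "homeomorphism U W (src G) \<sigma>"
    by (rule locally_trivial_chart[OF assms])
  obtain V where V: "open V" "W = units G \<inter> V"
    using W by (auto simp: openin_open)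
  have UW: "continuous_on W \<sigma>" "src G ` U = W" "\<sigma> ` W = U"
    "\<And>q. q \<in> U \<Longrightarrow> \<sigma> (src G q) = q" "\<And>v. v \<in> W \<Longrightarrow> src G (\<sigma> v) = v"
    using hom by (auto simp: homeomorphism_def)
  show thesis
  proof (rule that[of V \<sigma>])
    show "src G p \<in> V"
      using UW(2) U(1) V(2) by auto
    show "rng G (\<sigma> v) = rng G p \<and> src G (\<sigma> v) = v" if "v \<in> units G \<inter> V" for v
      using UW(3,5) V(2) that openin_imp_subset[OF U(2)] by (auto simp: rfib_def)
  qed (use V UW U in auto)
qed

text \<open>The source map is injective near \<open>p\<close> on the range fibre of
  \<open>p\<close>, which isolates \<open>p\<close> among the arrows with the same range and
  source.\<close>

lemma rsfib_discrete:
  assumes "locally_trivial G"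
  obtains U where "open U" "p \<in> U"
    "\<And>q. q \<in> U \<Longrightarrow> rng G q = rng G p \<Longrightarrow> src G q = src G p \<Longrightarrow> q = p"
proof -
  obtain U W \<sigma> where U: "p \<in> U" "openin (top_of_set (rfib G (rng G p))) U"
      and "openin (top_of_set (units G)) W" and hom: "homeomorphism U W (src G) \<sigma>"
    by (rule locally_trivial_chart[OF assms])
  obtain V where V: "open V" "U = rfib G (rng G p) \<inter> V"
    using U(2) by (auto simp: openin_open)
  have "q = p" if "q \<in> V" "rng G q = rng G p" "src G q = src G p" for q
    using homeomorphism_apply1[OF hom, of q] homeomorphism_apply1[OF hom, of p] U(1) V(2) that
    by (simp add: rfib_def)
  then show thesis
    using that[of V] V U(1) by blast
qed

end

section \<open>Closed range fibres and separation of arrows\<close>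

context locally_compact_groupoid
begin

text \<open>The sets are open among all arrows but disjoint only on the units; this suffices for
  separating by preimages, since \<open>rng G\<close> and \<open>src G\<close> take values in the
  units.\<close>

lemma units_separated:
  assumes "u \<in> units G" "v \<in> units G" "u \<noteq> v"
  obtains A B where "open A" "open B" "u \<in> A" "v \<in> B" "units G \<inter> A \<inter> B = {}"
proof -
  obtain A' B' where AB: "openin (top_of_set (units G)) A'" "openin (top_of_set (units G)) B'"
      "u \<in> A'" "v \<in> B'" "disjnt A' B'"
    using Hausdorff_units[unfolded Hausdorff_space_def, rule_format, of u v] assms by auto
  then obtain A B where "open A" "open B" "A' = units G \<inter> A" "B' = units G \<inter> B"
    by (auto simp: openin_open)
  with AB show thesis
    by (intro that[of A B]) (auto simp: disjnt_iff)
qed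

text \<open>Points of the Hausdorff unit space are relatively closed, and the fibre over a unit is
  the preimage of such a point under the continuous range map. Over a non-unit the fibre is
  empty.\<close>

lemma closed_rfib: "closed (rfib G x)"
proof (cases "x \<in> units G")
  case True
  have "closedin (top_of_set (units G)) {x}"
    using True Hausdorff_units by (simp add: closedin_Hausdorff_sing_eq)
  then obtain C where C: "closed C" "units G \<inter> C = {x}"
    by (auto simp: closedin_closed)
  then have "rfib G x = rng G -` C"
    using rng_in_units by (fastforce simp: rfib_def)
  moreover have "closed (rng G -` C)"
    using continuous_rng C(1) by (simp add: continuous_on_closed_vimage)
  ultimately show ?thesis
    by simp
next
  case False
  then have "rfib G x = {}"
    using rng_in_units by (auto simp: rfib_def)
  then show ?thesis
    by simp
qed

lemma locally_compact_space_arrows: "locally_compact_space (euclidean :: 'g topology)"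
proof -
  have "\<exists>U K. open U \<and> compact K \<and> \<gamma> \<in> U \<and> U \<subseteq> K" for \<gamma> :: 'g
    using compact_Hausdorff_nhd[of \<gamma>] by blast
  then show ?thesis
    by (simp add: locally_compact_space_def)
qed

text \<open>
  Two arrows \<open>g\<close>, \<open>h\<close> from \<open>s\<close> to \<open>r\<close> are separated by transporting a neighbourhood of both
  continuously, along local sections, into the discrete space \<open>rsfib G r s\<close>.
\<close>

lemma Hausdorff_space_arrows:
  assumes lt: "locally_trivial G"
  shows "Hausdorff_space (euclidean :: 'g topology)"
  unfolding Hausdorff_space_def
proof (intro allI impI)
  fix g h :: 'g
  assume "g \<in> topspace euclidean \<and> h \<in> topspace euclidean \<and> g \<noteq> h"
  then have "g \<noteq> h"
    by simp
  have "\<exists>A B. open A \<and> open B \<and> g \<in> A \<and> h \<in> B \<and> A \<inter> B = {}"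
  proof (cases "rng G g = rng G h \<and> src G g = src G h")
    case False
    then consider "rng G g \<noteq> rng G h" | "src G g \<noteq> src G h"
      by blast
    then show ?thesis
    proof cases
      case 1
      then obtain A B where AB: "open A" "open B" "rng G g \<in> A" "rng G h \<in> B" "units G \<inter> A \<inter> B = {}"
        using units_separated[of "rng G g" "rng G h"] by auto
      then have "rng G -` A \<inter> rng G -` B = {}"
        using rng_in_units by blast
      then show ?thesis
        using AB open_rng_vimage by (intro exI[of _ "rng G -` A"] exI[of _ "rng G -` B"]) auto
    next
      case 2
      then obtain A B where AB: "open A" "open B" "src G g \<in> A" "src G h \<in> B" "units G \<inter> A \<inter> B = {}"
        using units_separated[of "src G g" "src G h"] by auto
      then have "src G -` A \<inter> src G -` B = {}"
        using src_in_units by blast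
      then show ?thesis
        using AB open_src_vimage by (intro exI[of _ "src G -` A"] exI[of _ "src G -` B"]) auto
    qed
  next
    case True
    define r where "r = rng G g"
    define s where "s = src G g"
    have rs: "rng G r = r" "src G r = r" "rng G s = s" "src G s = s" "ginv G s = s"
      by (simp_all add: r_def s_def rng_rng src_rng rng_src src_src unit_ginv)
    \<comment> \<open>The sections pass through the units \<open>r\<close> and \<open>s\<close>
      themselves, so that transport along them will fix every arrow from \<open>s\<close> to
      \<open>r\<close>.\<close>
    obtain V \<sigma> where V: "open V" "r \<in> V" "continuous_on (units G \<inter> V) \<sigma>" "\<sigma> r = r"
        and \<sigma>: "\<And>v. v \<in> units G \<inter> V \<Longrightarrow> rng G (\<sigma> v) = r \<and> src G (\<sigma> v) = v"
      using locally_trivial_section[OF lt, of r] rs by metis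
    obtain W \<tau> where W: "open W" "s \<in> W" "continuous_on (units G \<inter> W) \<tau>" "\<tau> s = s"
        and \<tau>: "\<And>v. v \<in> units G \<inter> W \<Longrightarrow> rng G (\<tau> v) = s \<and> src G (\<tau> v) = v"
      using locally_trivial_section[OF lt, of s] rs by metis
    define N where "N = rng G -` V \<inter> src G -` W"
    have N: "open N"
      using V(1) W(1) by (simp add: N_def open_Int open_rng_vimage open_src_vimage)
    \<comment> \<open>The composite runs from \<open>s\<close> to \<open>src G k\<close> along the
      inverse of \<open>\<tau>\<close>, then along \<open>k\<close>, then from
      \<open>rng G k\<close> to \<open>r\<close> along \<open>\<sigma>\<close>.\<close>
    define \<Phi> where "\<Phi> k = gmul G (\<sigma> (rng G k)) (gmul G k (ginv G (\<tau> (src G k))))" for k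
    have cont: "continuous_on N \<Phi>"
      unfolding \<Phi>_def
    proof (intro continuous_on_gmul continuous_on_ginv continuous_on_id)
      show "continuous_on N (\<lambda>k. \<sigma> (rng G k))"
        by (rule continuous_on_compose2[OF V(3) continuous_on_subset[OF continuous_rng]])
          (auto simp: N_def)
      show "continuous_on N (\<lambda>k. \<tau> (src G k))"
        by (rule continuous_on_compose2[OF W(3) continuous_on_subset[OF continuous_src]])
          (auto simp: N_def)
    qed (use \<sigma> \<tau> in \<open>auto simp: N_def rng_gmul rng_ginv\<close>)
    have \<Phi>: "rng G (\<Phi> k) = r" "src G (\<Phi> k) = s" if "k \<in> N" for k
      using that \<sigma>[of "rng G k"] \<tau>[of "src G k"]
      by (auto simp: \<Phi>_def N_def rng_gmul src_gmul rng_ginv src_ginv)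
    have ru: "r \<in> units G" "s \<in> units G"
      by (simp_all add: r_def s_def)
    have \<Phi>_fix: "\<Phi> k = k" if "rng G k = r" "src G k = s" for k
      using that ru V(4) W(4) rs by (simp add: \<Phi>_def gmul_unit_left gmul_unit_right)
    have gh: "rng G g = r" "src G g = s" "rng G h = r" "src G h = s"
      using True by (simp_all add: r_def s_def)
    obtain A where A: "open A" "g \<in> A" "\<And>q. q \<in> A \<Longrightarrow> rng G q = r \<Longrightarrow> src G q = s \<Longrightarrow> q = g"
      using rsfib_discrete[OF lt, of g] gh by metis
    obtain B where B: "open B" "h \<in> B" "\<And>q. q \<in> B \<Longrightarrow> rng G q = r \<Longrightarrow> src G q = s \<Longrightarrow> q = h"
      using rsfib_discrete[OF lt, of h] gh by metis
    have "open (\<Phi> -` A \<inter> N)" "open (\<Phi> -` B \<inter> N)"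
      using cont N A(1) B(1) by (simp_all add: continuous_on_open_vimage)
    moreover have "g \<in> \<Phi> -` A \<inter> N" "h \<in> \<Phi> -` B \<inter> N"
      using gh \<Phi>_fix A(2) B(2) V(2) W(2) by (simp_all add: N_def)
    \<comment> \<open>At a common point the value of \<open>\<Phi>\<close> would be an arrow from
      \<open>s\<close> to \<open>r\<close> in both \<open>A\<close> and \<open>B\<close>, hence
      equal to both \<open>g\<close> and \<open>h\<close>.\<close>
    moreover have "(\<Phi> -` A \<inter> N) \<inter> (\<Phi> -` B \<inter> N) = {}"
    proof -
      have False if "k \<in> N" "\<Phi> k \<in> A" "\<Phi> k \<in> B" for k
        using A(3)[OF that(2)] B(3)[OF that(3)] \<Phi>[OF that(1)] \<open>g \<noteq> h\<close> by simp
      then show ?thesis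
        by blast
    qed
    ultimately show ?thesis
      by blast
  qed
  then show "\<exists>A B. openin euclidean A \<and> openin euclidean B \<and> g \<in> A \<and> h \<in> B \<and> disjnt A B"
    by (simp add: disjnt_def)
qed

end

section \<open>The induced Haar system\<close>

text \<open>A candidate for the induced measure that keeps the chosen arrow \<open>\<eta>\<close>
  explicit, as an image measure.\<close>

definition translate_measure ::
  "'g::topological_space groupoid_ops \<Rightarrow> 'g measure \<Rightarrow> 'g \<Rightarrow> 'g measure" where
  "translate_measure G L \<eta> = distr L borel (\<lambda>z. gmul G (ginv G \<eta>) z)"

locale invariant_transversal_measure = locally_compact_groupoid G
  for G :: "'g::topological_space groupoid_ops" +
  fixes x :: 'g and L :: "'g measure"
  assumes local_trivial: "locally_trivial G"
    and unit_x: "x \<in> units G"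
    and radon: "radon_measure_on (rfib G x) L"
    and full_support: "measure_support L = rfib G x"
    and invariant: "isotropy_invariant G x L"
begin

lemma Hausdorff_G: "Hausdorff_space (euclidean :: 'g topology)"
  using Hausdorff_space_arrows[OF local_trivial] .

text \<open>Supplies closed neighbourhoods inside the domain of a local section.\<close>

lemma regular_arrows: "regular_space (euclidean :: 'g topology)"
  using locally_compact_Hausdorff_imp_regular_space[OF locally_compact_space_arrows Hausdorff_G] .

lemma compact_closed: "compact (K :: 'g set) \<Longrightarrow> closed K"
  using compactin_imp_closedin[OF Hausdorff_G] by simp

lemma space_L: "space L = rfib G x"
  using radon_measure_on_space[OF radon] .

lemma rsfib_nonempty:
  assumes "w \<in> units G"
  shows "rsfib G x w \<noteq> {}"
proof -
  have "w \<in> src G ` rfib G x"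
    using local_trivial unit_x assms by (simp add: locally_trivial_def)
  then show ?thesis
    by (auto simp: rsfib_def sfib_def)
qed

section \<open>Translates of the transversal measure and their independence of the arrow\<close>

lemma translate_homeomorphism:
  "\<eta> \<in> rsfib G x w \<Longrightarrow> homeomorphism (rfib G x) (rfib G w) (gmul G (ginv G \<eta>)) (gmul G \<eta>)"
  using homeomorphism_gmul_ginv[of \<eta>] by (auto simp: rsfib_def rfib_def sfib_def)

lemma translate_measurable:
  "\<eta> \<in> rsfib G x w \<Longrightarrow> gmul G (ginv G \<eta>) \<in> measurable L borel"
  using measurable_homeomorphism[OF radon closed_rfib translate_homeomorphism] .

lemma emeasure_translate:
  assumes "\<eta> \<in> rsfib G x w" "A \<in> sets borel"
  shows "emeasure (translate_measure G L \<eta>) A = emeasure L (rfib G x \<inter> gmul G (ginv G \<eta>) -` A)"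
  unfolding translate_measure_def
  using emeasure_distr_homeomorphism[OF radon closed_rfib translate_homeomorphism[OF assms(1)] assms(2)] .

lemma integral_translate:
  assumes "\<eta> \<in> rsfib G x w" "f \<in> borel_measurable borel"
  shows "integral\<^sup>L (translate_measure G L \<eta>) f = (LINT z|L. f (gmul G (ginv G \<eta>) z) :: complex)"
  unfolding translate_measure_def
  using integral_distr[OF translate_measurable[OF assms(1)] assms(2)] .

lemma radon_translate:
  "\<eta> \<in> rsfib G x w \<Longrightarrow> radon_measure_on UNIV (translate_measure G L \<eta>)"
  unfolding translate_measure_def
  using radon_measure_on_distr[OF radon closed_rfib translate_homeomorphism Hausdorff_G] .

text \<open>The arrows differ by the isotropy element \<open>\<gamma>\<close>, the product of
  \<open>\<eta>\<close> and the inverse of \<open>\<eta>'\<close>. Left multiplication by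
  \<open>\<gamma>\<close> carries the preimage of \<open>A\<close> belonging to
  \<open>\<eta>'\<close> onto the one belonging to \<open>\<eta>\<close>, and \<open>L\<close> is
  invariant under it.\<close>

lemma translate_measure_eq:
  assumes \<eta>: "\<eta> \<in> rsfib G x w" and \<eta>': "\<eta>' \<in> rsfib G x w"
  shows "translate_measure G L \<eta> = translate_measure G L \<eta>'"
proof (rule measure_eqI)
  show "sets (translate_measure G L \<eta>) = sets (translate_measure G L \<eta>')"
    by (simp add: translate_measure_def)
  fix A assume "A \<in> sets (translate_measure G L \<eta>)"
  then have A: "A \<in> sets borel"
    by (simp add: translate_measure_def)
  define \<gamma> where "\<gamma> = gmul G \<eta> (ginv G \<eta>')"
  have \<gamma>: "\<gamma> \<in> rsfib G x x"
    using gmul_ginv_in_rsfib[OF \<eta> \<eta>'] by (simp add: \<gamma>_def)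
  have e: "rng G \<eta> = x" "src G \<eta> = w" "rng G \<eta>' = x" "src G \<eta>' = w" "rng G \<gamma> = x" "src G \<gamma> = x"
    using \<eta> \<eta>' \<gamma> by (auto simp: rsfib_def rfib_def sfib_def)
  have shift: "gmul G (ginv G \<eta>) (gmul G \<gamma> z) = gmul G (ginv G \<eta>') z" if "rng G z = x" for z
    using that e by (simp add: \<gamma>_def gmul_gmul_ginv ginv_gmul_cancel_left rng_gmul_ginv)
  let ?B = "rfib G x \<inter> gmul G (ginv G \<eta>) -` A" and ?B' = "rfib G x \<inter> gmul G (ginv G \<eta>') -` A"
  have "?B = gmul G \<gamma> ` ?B'"
  proof
    show "gmul G \<gamma> ` ?B' \<subseteq> ?B"
      using shift e by (auto simp: rfib_def rng_gmul)
    show "?B \<subseteq> gmul G \<gamma> ` ?B'"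
    proof
      fix z assume z: "z \<in> ?B"
      let ?y = "gmul G (ginv G \<gamma>) z"
      have y: "rng G ?y = x" "gmul G \<gamma> ?y = z"
        using z e by (simp_all add: rfib_def rng_gmul_ginv gmul_ginv_cancel_left)
      with z shift[of ?y] show "z \<in> gmul G \<gamma> ` ?B'"
        by (intro image_eqI[of _ _ ?y]) (auto simp: rfib_def)
    qed
  qed
  moreover have "?B' \<in> sets L"
    using measurable_sets[OF translate_measurable[OF \<eta>'] A] space_L by (simp add: Int_commute)
  ultimately show "emeasure (translate_measure G L \<eta>) A = emeasure (translate_measure G L \<eta>') A"
    using invariant \<gamma> by (simp add: emeasure_translate[OF \<eta> A] emeasure_translate[OF \<eta>' A]
        isotropy_invariant_def)
qed

text \<open>The measure uses one arrow and the integrand another, because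
  \<open>is_translate\<close> demands the formula for every arrow at once.\<close>

lemma integral_Cc_translate:
  assumes "\<eta> \<in> rsfib G x w" "\<eta>' \<in> rsfib G x w" "g \<in> Cc UNIV"
  shows "integral\<^sup>L (translate_measure G L \<eta>) g = (LINT z|L. g (gmul G (ginv G \<eta>') z))"
  using integral_translate[OF assms(2) Cc_borel_measurable[OF assms(3)]]
    translate_measure_eq[OF assms(1,2)] by simp

text \<open>Integrals over \<open>Cc UNIV\<close> determine a Radon measure, which gives uniqueness;
  the image measure satisfies the formula for all arrows, which gives existence. This evaluates the
  \<open>THE\<close> in \<open>induced_system\<close>.\<close>

lemma is_translate_iff:
  assumes "\<eta> \<in> rsfib G x w"
  shows "is_translate G x L w M \<longleftrightarrow> M = translate_measure G L \<eta>"
proof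
  assume M: "is_translate G x L w M"
  show "M = translate_measure G L \<eta>"
  proof (rule radon_measure_on_eqI[OF Hausdorff_G locally_compact_space_arrows])
    fix g :: "'g \<Rightarrow> complex" assume "g \<in> Cc UNIV"
    then show "integral\<^sup>L M g = integral\<^sup>L (translate_measure G L \<eta>) g"
      using M assms integral_Cc_translate[OF assms assms] by (simp add: is_translate_def)
  qed (use M radon_translate[OF assms] in \<open>simp_all add: is_translate_def\<close>)
next
  assume "M = translate_measure G L \<eta>"
  then show "is_translate G x L w M"
    using radon_translate[OF assms] integral_Cc_translate[OF assms] by (simp add: is_translate_def)
qed

lemma induced_system_eq:
  "\<eta> \<in> rsfib G x w \<Longrightarrow> induced_system G x L w = translate_measure G L \<eta>"
  by (simp add: induced_system_def is_translate_iff)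

text \<open>The translation lands in \<open>rfib G u\<close>, so the open complement of this fibre
  is null. A neighbourhood of a point \<open>p\<close> of the fibre pulls back to a relative
  neighbourhood of the product of \<open>\<eta>\<close> and \<open>p\<close>, which has positive
  measure because \<open>L\<close> has full support.\<close>

lemma measure_support_translate:
  assumes \<eta>: "\<eta> \<in> rsfib G x u"
  shows "measure_support (translate_measure G L \<eta>) = rfib G u"
proof
  let ?f = "gmul G (ginv G \<eta>)" and ?M = "translate_measure G L \<eta>"
  have space: "space ?M = UNIV"
    by (simp add: translate_measure_def)
  have e: "rng G \<eta> = x" "src G \<eta> = u"
    using \<eta> by (auto simp: rsfib_def rfib_def sfib_def)
  show "measure_support ?M \<subseteq> rfib G u"
  proof
    fix p assume p: "p \<in> measure_support ?M"
    show "p \<in> rfib G u"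
    proof (rule ccontr)
      assume "p \<notin> rfib G u"
      then have "emeasure ?M (- rfib G u) > 0"
        using p closed_rfib[of u] space by (auto simp: measure_support_def open_Compl)
      moreover have "rfib G x \<inter> ?f -` (- rfib G u) = {}"
        using e by (auto simp: rfib_def rng_gmul_ginv)
      ultimately show False
        using closed_rfib[of u] by (simp add: emeasure_translate[OF \<eta>])
    qed
  qed
  show "rfib G u \<subseteq> measure_support ?M"
  proof
    fix p assume p: "p \<in> rfib G u"
    have "emeasure ?M U > 0" if U: "open U" "p \<in> U" for U
    proof -
      have "openin (top_of_set (rfib G x)) (rfib G x \<inter> ?f -` U)"
        using U(1) translate_homeomorphism[OF \<eta>]
        by (intro continuous_openin_preimage_gen) (auto simp: homeomorphism_def)
      then obtain W where W: "open W" "rfib G x \<inter> ?f -` U = rfib G x \<inter> W"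
        by (auto simp: openin_open)
      have "gmul G \<eta> p \<in> rfib G x" "?f (gmul G \<eta> p) = p"
        using p e by (simp_all add: rfib_def rng_gmul ginv_gmul_cancel_left)
      then have "gmul G \<eta> p \<in> W" "gmul G \<eta> p \<in> measure_support L"
        using W(2) U(2) full_support by auto
      then have "emeasure L (W \<inter> rfib G x) > 0"
        using W(1) space_L by (simp add: measure_support_def)
      then show ?thesis
        using U(1) W(2) by (simp add: emeasure_translate[OF \<eta>] Int_commute)
    qed
    then show "p \<in> measure_support ?M"
      using space by (simp add: measure_support_def)
  qed
qed

section \<open>Continuity, compact support and left invariance of the integrals\<close>

lemma integral_induced_system:
  assumes "f \<in> Cc UNIV" "\<eta> \<in> rsfib G x u"
  shows "integral\<^sup>L (induced_system G x L u) f = (LINT z|L. f (gmul G (ginv G \<eta>) z))"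
  using assms integral_Cc_translate[OF assms(2,2,1)] by (simp add: induced_system_eq)

lemma integrable_translate:
  assumes "f \<in> Cc UNIV" "\<eta> \<in> rsfib G x u"
  shows "integrable L (\<lambda>z. f (gmul G (ginv G \<eta>) z))"
  using radon_measure_on_UNIV_integrable_Cc[OF radon_translate[OF assms(2)] assms(1)]
    integrable_distr_eq[OF translate_measurable[OF assms(2)] Cc_borel_measurable[OF assms(1)]]
  by (simp add: translate_measure_def)

text \<open>
  Along a local section \<open>\<sigma>\<close> of \<open>src G\<close> the functions \<open>z \<mapsto> f (\<sigma>(u)\<inverse> z)\<close> are supported in one
  compact set \<open>K\<close>, on which their dependence on \<open>u\<close> is continuous uniformly in \<open>z\<close>.
\<close>

lemma continuous_on_integral_induced_system:
  assumes f: "f \<in> Cc UNIV"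
  shows "continuous_on (units G) (\<lambda>u. integral\<^sup>L (induced_system G x L u) f)"
  unfolding continuous_on_def
proof (intro ballI tendstoI)
  let ?F = "\<lambda>u. integral\<^sup>L (induced_system G x L u) f"
  fix u0 and e :: real assume u0: "u0 \<in> units G" and e: "e > 0"
  obtain p where p: "p \<in> rsfib G x u0"
    using rsfib_nonempty[OF u0] by blast
  have p_eq: "rng G p = x" "src G p = u0"
    using p by (simp_all add: rsfib_def rfib_def sfib_def)
  obtain V \<sigma> where V: "open V" "u0 \<in> V" "continuous_on (units G \<inter> V) \<sigma>" "\<sigma> u0 = p"
      and \<sigma>: "\<And>v. v \<in> units G \<inter> V \<Longrightarrow> rng G (\<sigma> v) = x \<and> src G (\<sigma> v) = v"
    using locally_trivial_section[OF local_trivial, of p] p_eq by metis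
  \<comment> \<open>A closed neighbourhood is needed: closedness of \<open>C\<close> makes
    \<open>D\<close> compact, while \<open>C \<subseteq> V\<close> keeps the section defined on
    it.\<close>
  obtain U C where UC: "open U" "closed C" "u0 \<in> U" "U \<subseteq> C" "C \<subseteq> V"
    using regular_arrows V(1,2)
    unfolding neighbourhood_base_of_closedin[symmetric] neighbourhood_base_of
    by (metis closed_closedin open_openin)
  define D where "D = closure {z. f z \<noteq> 0} \<inter> rng G -` C"
  \<comment> \<open>If the integrand at a unit \<open>u\<close> in \<open>C\<close> is nonzero at
    \<open>z\<close>, the inverse of \<open>\<sigma> u\<close> times \<open>z\<close> lies in
    \<open>D\<close> and has range \<open>u\<close>; multiplying by \<open>\<sigma> u\<close> gives
    back \<open>z\<close>, so \<open>z\<close> lies in \<open>K\<close>.\<close>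
  define K where "K = (\<lambda>k. gmul G (\<sigma> (rng G k)) k) ` D"
  have "closed (rng G -` C)"
    using continuous_rng UC(2) by (simp add: continuous_on_closed_vimage)
  then have "compact D"
    using f by (auto simp: D_def Cc_def)
  moreover have "continuous_on D (\<lambda>k. gmul G (\<sigma> (rng G k)) k)"
  proof (rule continuous_on_gmul)
    show "continuous_on D (\<lambda>k. \<sigma> (rng G k))"
      by (rule continuous_on_compose2[OF V(3) continuous_on_subset[OF continuous_rng]])
        (use UC in \<open>auto simp: D_def\<close>)
  qed (use \<sigma> UC in \<open>auto simp: D_def\<close>)
  ultimately have K: "compact K"
    unfolding K_def by (rule compact_continuous_image[rotated])
  have KS: "K \<subseteq> rfib G x"
    using \<sigma> UC by (auto simp: K_def D_def rfib_def rng_gmul)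
  have "K \<in> sets L"
    using KS compact_closed[OF K] closed_rfib[of x]
    by (simp add: radon_measure_on_sets[OF radon] sets_restrict_space_iff)
  have "emeasure L K < \<infinity>"
    using radon_measure_on_finite[OF radon K KS] .
  define h where "h = (\<lambda>(u, z). f (gmul G (ginv G (\<sigma> u)) z))"
  have cont: "continuous_on ((units G \<inter> C) \<times> K) h"
  proof -
    have "continuous_on ((units G \<inter> C) \<times> K) (\<lambda>q. gmul G (ginv G (\<sigma> (fst q))) (snd q))"
    proof (intro continuous_on_gmul continuous_on_ginv)
      show "continuous_on ((units G \<inter> C) \<times> K) (\<lambda>q. \<sigma> (fst q))"
        by (rule continuous_on_compose2[OF V(3) continuous_on_fst[OF continuous_on_id]])
          (use UC in auto)
      fix q assume "q \<in> (units G \<inter> C) \<times> K"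
      then have "fst q \<in> units G \<inter> V" "snd q \<in> rfib G x"
        using UC KS by auto
      then show "src G (ginv G (\<sigma> (fst q))) = rng G (snd q)"
        using \<sigma>[of "fst q"] by (simp add: src_ginv rfib_def)
    qed (intro continuous_intros)
    then show ?thesis
      using f continuous_on_compose2[of UNIV f] by (auto simp: h_def Cc_def case_prod_beta)
  qed
  \<comment> \<open>The added 1 allows for \<open>K\<close> of measure zero and makes the final
    estimate strict.\<close>
  have pos: "0 < e / (measure L K + 1)"
    using e by (simp add: add_nonneg_pos)
  have u0C: "u0 \<in> units G \<inter> C"
    using u0 UC by blast
  \<comment> \<open>Compactness of \<open>K\<close> turns joint continuity into closeness uniform in
    \<open>z\<close>.\<close>
  obtain X where X: "u0 \<in> X" "open X"
      "\<forall>u\<in>X \<inter> (units G \<inter> C). \<forall>z\<in>K. dist (h (u, z)) (h (u0, z)) \<le> e / (measure L K + 1)"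
    using continuous_on_prod_compactE[OF cont K u0C pos] by blast
  have zero: "h (u, z) = 0" if u: "u \<in> units G \<inter> C" and z: "z \<in> rfib G x - K" for u z
  proof (rule ccontr)
    assume nz: "h (u, z) \<noteq> 0"
    let ?k = "gmul G (ginv G (\<sigma> u)) z"
    have "rng G (\<sigma> u) = x" "src G (\<sigma> u) = u" "rng G z = x"
      using \<sigma>[of u] u z UC by (auto simp: rfib_def)
    then have k: "rng G ?k = u" "gmul G (\<sigma> u) ?k = z"
      by (simp_all add: rng_gmul_ginv gmul_ginv_cancel_left)
    have "?k \<in> D"
      using nz u k closure_subset[of "{z. f z \<noteq> 0}"] by (auto simp: D_def h_def)
    then have "z \<in> K"
      unfolding K_def using k by (intro image_eqI[of _ _ ?k]) auto
    then show False
      using z by blast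
  qed
  have F: "?F u = (LINT z|L. h (u, z))" "integrable L (\<lambda>z. h (u, z))" if "u \<in> units G \<inter> C" for u
  proof -
    have "\<sigma> u \<in> rsfib G x u"
      using \<sigma>[of u] that UC by (auto simp: rsfib_def rfib_def sfib_def)
    then show "?F u = (LINT z|L. h (u, z))" "integrable L (\<lambda>z. h (u, z))"
      using integral_induced_system[OF f] integrable_translate[OF f] by (simp_all add: h_def)
  qed
  have close: "dist (?F u) (?F u0) < e" if u: "u \<in> X \<inter> U" "u \<in> units G" for u
  proof -
    let ?d = "e / (measure L K + 1)"
    have uC: "u \<in> units G \<inter> C" "u0 \<in> units G \<inter> C"
      using u u0 UC by blast+
    have "norm (?F u - ?F u0) = norm (LINT z|L. h (u, z) - h (u0, z))"
      using F[OF uC(1)] F[OF uC(2)] by simp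
    also have "\<dots> \<le> (LINT z|L. norm (h (u, z) - h (u0, z)))"
      by (rule integral_norm_bound)
    also have "\<dots> \<le> (LINT z|L. indicator K z * ?d)"
    proof (rule integral_mono)
      show "integrable L (\<lambda>z. norm (h (u, z) - h (u0, z)))"
        using F uC by simp
      show "integrable L (\<lambda>z. indicator K z * ?d)"
        using \<open>K \<in> sets L\<close> \<open>emeasure L K < \<infinity>\<close> by simp
      fix z assume "z \<in> space L"
      then show "norm (h (u, z) - h (u0, z)) \<le> indicator K z * ?d"
        using X(3) zero[OF uC(1)] zero[OF uC(2)] u uC by (cases "z \<in> K") (auto simp: space_L dist_norm)
    qed
    also have "\<dots> = measure L K * ?d"
      using \<open>K \<in> sets L\<close> by (simp add: sets.Int_space_eq2)
    also have "\<dots> < e"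
      using e by (simp add: divide_simps add_nonneg_pos)
    finally show ?thesis
      by (simp add: dist_norm)
  qed
  then show "\<forall>\<^sub>F u in at u0 within units G. dist (?F u) (?F u0) < e"
    unfolding eventually_at_topological
    using X(1,2) UC(1,3) by (intro exI[of _ "X \<inter> U"]) auto
qed

text \<open>The integral at \<open>u\<close> can be nonzero only if \<open>f\<close> is nonzero at
  some arrow with range \<open>u\<close>, so the support lies in the image under
  \<open>rng G\<close> of the compact support of \<open>f\<close>.\<close>

lemma integral_induced_system_Cc:
  assumes f: "f \<in> Cc UNIV"
  shows "(\<lambda>u. integral\<^sup>L (induced_system G x L u) f) \<in> Cc (units G)"
proof -
  let ?F = "\<lambda>u. integral\<^sup>L (induced_system G x L u) f"
  define Q where "Q = rng G ` closure {z. f z \<noteq> 0}"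
  have Q: "compact Q"
    unfolding Q_def using f continuous_rng
    by (intro compact_continuous_image) (auto simp: Cc_def intro: continuous_on_subset)
  have "{u \<in> units G. ?F u \<noteq> 0} \<subseteq> Q"
  proof clarify
    fix u assume u: "u \<in> units G" "?F u \<noteq> 0"
    obtain \<eta> where \<eta>: "\<eta> \<in> rsfib G x u"
      using rsfib_nonempty[OF u(1)] by blast
    have "\<exists>z\<in>space L. f (gmul G (ginv G \<eta>) z) \<noteq> 0"
    proof (rule ccontr)
      assume "\<not> ?thesis"
      then have "(LINT z|L. f (gmul G (ginv G \<eta>) z)) = (LINT z|L. 0)"
        by (intro Bochner_Integration.integral_cong) auto
      then show False
        using u(2) integral_induced_system[OF f \<eta>] by simp
    qed
    then obtain z where z: "z \<in> rfib G x" "f (gmul G (ginv G \<eta>) z) \<noteq> 0"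
      using space_L by auto
    have "rng G (gmul G (ginv G \<eta>) z) = u"
      using \<eta> z(1) by (simp add: rsfib_def rfib_def sfib_def rng_gmul_ginv)
    then show "u \<in> Q"
      unfolding Q_def using z(2) closure_subset[of "{z. f z \<noteq> 0}"]
      by (intro image_eqI[of _ _ "gmul G (ginv G \<eta>) z"]) auto
  qed
  \<comment> \<open>A compact set of arrows is closed by the Hausdorff property, so it contains the
    closure taken among all arrows.\<close>
  then have "closure {u \<in> units G. ?F u \<noteq> 0} \<subseteq> Q"
    using compact_closed[OF Q] by (rule closure_minimal)
  moreover have "Q \<subseteq> units G"
    by (auto simp: Q_def)
  ultimately have "units G \<inter> closure {u \<in> units G. ?F u \<noteq> 0} = Q \<inter> closure {u \<in> units G. ?F u \<noteq> 0}"
    by blast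
  then have "compact (units G \<inter> closure {u \<in> units G. ?F u \<noteq> 0})"
    using Q by (simp add: compact_Int_closed)
  then show ?thesis
    using continuous_on_integral_induced_system[OF f] by (simp add: Cc_def)
qed

text \<open>If \<open>\<zeta>\<close> is an arrow for \<open>src G \<gamma>\<close>, then
  \<open>\<zeta>\<close> times the inverse of \<open>\<gamma>\<close> is one for
  \<open>rng G \<gamma>\<close>. With these choices both sides become the same integral over
  \<open>L\<close>.\<close>

lemma induced_system_invariant:
  assumes f: "f \<in> Cc UNIV"
  shows "(LINT \<eta>:rfib G (src G \<gamma>)|induced_system G x L (src G \<gamma>). f (gmul G \<gamma> \<eta>)) =
    (LINT \<eta>:rfib G (rng G \<gamma>)|induced_system G x L (rng G \<gamma>). f \<eta>)"
proof -
  obtain \<zeta> where \<zeta>: "\<zeta> \<in> rsfib G x (src G \<gamma>)"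
    using rsfib_nonempty[OF src_in_units[of \<gamma>]] by blast
  define \<eta> where "\<eta> = gmul G \<zeta> (ginv G \<gamma>)"
  have \<eta>: "\<eta> \<in> rsfib G x (rng G \<gamma>)"
    unfolding \<eta>_def using gmul_ginv_in_rsfib[OF \<zeta>, of \<gamma>] by (simp add: rsfib_def rfib_def sfib_def)
  have e: "rng G \<zeta> = x" "src G \<zeta> = src G \<gamma>" "rng G \<eta> = x" "src G \<eta> = rng G \<gamma>"
    using \<zeta> \<eta> by (auto simp: rsfib_def rfib_def sfib_def)
  have cont: "continuous_on UNIV f"
    using f by (simp add: Cc_def)
  have "continuous_on (rfib G (src G \<gamma>)) (\<lambda>k. f (gmul G \<gamma> k))"
    by (rule continuous_on_compose2[OF cont continuous_on_gmul]) (auto simp: rfib_def)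
  \<comment> \<open>Off the fibre the product is unspecified; cutting off by the indicator of the
    closed fibre gives a Borel function on all arrows.\<close>
  then have "(\<lambda>k. indicator (rfib G (src G \<gamma>)) k *\<^sub>R f (gmul G \<gamma> k)) \<in> borel_measurable borel"
    using closed_rfib by (intro borel_measurable_continuous_on_indicator) auto
  then have 1: "(LINT k:rfib G (src G \<gamma>)|induced_system G x L (src G \<gamma>). f (gmul G \<gamma> k)) =
      (LINT z|L. indicator (rfib G (src G \<gamma>)) (gmul G (ginv G \<zeta>) z) *\<^sub>R
        f (gmul G \<gamma> (gmul G (ginv G \<zeta>) z)))"
    unfolding set_lebesgue_integral_def induced_system_eq[OF \<zeta>] by (rule integral_translate[OF \<zeta>])
  have "(\<lambda>k. indicator (rfib G (rng G \<gamma>)) k *\<^sub>R f k) \<in> borel_measurable borel"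
    using closed_rfib cont
    by (intro borel_measurable_continuous_on_indicator) (auto intro: continuous_on_subset)
  then have 2: "(LINT k:rfib G (rng G \<gamma>)|induced_system G x L (rng G \<gamma>). f k) =
      (LINT z|L. indicator (rfib G (rng G \<gamma>)) (gmul G (ginv G \<eta>) z) *\<^sub>R f (gmul G (ginv G \<eta>) z))"
    unfolding set_lebesgue_integral_def induced_system_eq[OF \<eta>] by (rule integral_translate[OF \<eta>])
  have "gmul G (ginv G \<eta>) z = gmul G \<gamma> (gmul G (ginv G \<zeta>) z)" if "rng G z = x" for z
  proof -
    let ?y = "gmul G \<gamma> (gmul G (ginv G \<zeta>) z)"
    have y: "rng G ?y = rng G \<gamma>"
      using that e by (simp add: rng_gmul rng_gmul_ginv)
    \<comment> \<open>In this product the inverse of \<open>\<gamma>\<close> cancels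
      \<open>\<gamma>\<close> and then \<open>\<zeta>\<close> cancels its inverse; multiplying by
      the inverse of \<open>\<eta>\<close> gives the claim.\<close>
    have "gmul G \<eta> ?y = z"
      using that e y
      by (simp add: \<eta>_def gmul_gmul_ginv ginv_gmul_cancel_left rng_gmul_ginv gmul_ginv_cancel_left)
    then show ?thesis
      using ginv_gmul_cancel_left[of ?y \<eta>] y e by simp
  qed
  then show ?thesis
    unfolding 1 2 using e
    by (intro Bochner_Integration.integral_cong refl)
      (auto simp: space_L rfib_def indicator_def rng_gmul rng_gmul_ginv)
qed

lemma haar_system_induced_system: "haar_system G (induced_system G x L)"
  unfolding haar_system_def
proof (intro conjI ballI allI)
  fix u assume "u \<in> units G"
  then obtain \<eta> where \<eta>: "\<eta> \<in> rsfib G x u"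
    using rsfib_nonempty by blast
  show "radon_measure_on UNIV (induced_system G x L u)"
    using radon_translate[OF \<eta>] by (simp add: induced_system_eq[OF \<eta>])
  show "measure_support (induced_system G x L u) = rfib G u"
    using measure_support_translate[OF \<eta>] by (simp add: induced_system_eq[OF \<eta>])
qed (use integral_induced_system_Cc induced_system_invariant in auto)

end

theorem proposition2p10:
  fixes G :: "'g::topological_space groupoid_ops"
    and x :: 'g
    and L :: "'g measure"
  assumes "locally_compact_groupoid G"
    and "locally_trivial G"
    and "x \<in> units G"
    and "radon_measure_on (rfib G x) L"
    and "measure_support L = rfib G x"
    and "isotropy_invariant G x L"
  shows "(\<forall>w\<in>units G. rsfib G x w \<noteq> {} \<and>
            (\<forall>\<eta>\<in>rsfib G x w. \<forall>\<eta>'\<in>rsfib G x w. \<forall>g\<in>Cc UNIV.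
               (LINT z|L. g (gmul G (ginv G \<eta>) z)) = (LINT z|L. g (gmul G (ginv G \<eta>') z))) \<and>
            (\<exists>!M. is_translate G x L w M)) \<and>
         haar_system G (induced_system G x L)"
proof -
  interpret locally_compact_groupoid G
    by (rule assms(1))
  interpret invariant_transversal_measure G x L
    by unfold_locales (use assms in auto)
  have "\<exists>!M. is_translate G x L w M" if w: "w \<in> units G" for w
  proof -
    obtain \<eta> where \<eta>: "\<eta> \<in> rsfib G x w"
      using rsfib_nonempty[OF w] by blast
    show ?thesis
      by (simp add: is_translate_iff[OF \<eta>])
  qed
  then show ?thesis
    using rsfib_nonempty integral_Cc_translate haar_system_induced_system by metis
qed

end
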